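(* There is an absolute constant $c>0$ such that for the 1 Or 3 CA $\lambda$ started from a uniformly random initial configuration on $\mathbb Z$, $$\mathbf P\bigl(\exists\text{ an empty diagonal path from }\mathbb Z\times\{0\}\text{ to }(0,t)\bigr)<e^{-ct},\qquad t>0.$$ The same conclusion holds for the existence of a wide path (i.e. $\mathbf P(\exists\text{ a wide path from }\mathbb Z\times\{0\}\text{ to }(0,t))<e^{-ct}$ for all $t>0$, for some absolute constant $c>0$).
   Context: The 1 Or 3 CA is the evolution on $\{0,1\}^{\mathbb Z}$ given by $\lambda_{t+1}(x)=\lambda_t(x-1)+\lambda_t(x)+\lambda_t(x+1)\bmod 2$, $t=0,1,2,\dots$; write $\lambda(x,t)=\lambda_t(x)$. Uniformly random on $\mathbb Z$ means that the values $\lambda_0(x)$, $x\in\mathbb Z$, are independent and take values $0,1$ with probability $1/2$ each. Times $t$ are integers. A path is a finite or infinite sequence of space–time points $(x_0,t_0),(x_1,t_1),\dots$ in $\mathbb Z\times[0,\infty)$ with $t_{i+1}=t_i+1$ and $|x_{i+1}-x_i|\le 1$ for all $i$. A path is diagonal if $|x_{i+1}-x_i|=1$ for all $i$. A path is empty if $\lambda(x,t)=0$ for every $(x,t)$ on it. A path is wide if it is empty and it has no two consecutive points $(x,t),(y,t+1)$ with $|x-y|=1$ and $\lambda(y,t)=\lambda(x,t+1)=1$. A path from a set $A$ to a point is a path whose first point is in $A$ and whose last point is that point. *)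

theory Defs
  imports "HOL-Probability.Probability"
begin

primrec one_or_three :: "(int \<Rightarrow> nat) \<Rightarrow> nat \<Rightarrow> int \<Rightarrow> nat" where
  "one_or_three w 0 = w"
| "one_or_three w (Suc t) =
    (\<lambda>x. (one_or_three w t (x - 1) + one_or_three w t x + one_or_three w t (x + 1)) mod 2)"

(* The sample space consists of the functions from int into {0,1}. *)
definition uniform_config :: "(int \<Rightarrow> nat) measure" where
  "uniform_config = PiM UNIV (\<lambda>_. uniform_count_measure {0, 1})"

text \<open>
  A point is a pair \<open>(x, t)\<close> of a position and a time, and \<open>l t x\<close> is the value of a space-time
  configuration \<open>l\<close> there. Paths are nonempty lists: infinite paths have no last point, so they
  never lead from a set to a point.
\<close>

definition st_path :: "(int \<times> nat) list \<Rightarrow> bool" where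
  "st_path p \<longleftrightarrow> p \<noteq> [] \<and>
    (\<forall>i. Suc i < length p \<longrightarrow>
      snd (p ! Suc i) = snd (p ! i) + 1 \<and> \<bar>fst (p ! Suc i) - fst (p ! i)\<bar> \<le> 1)"

definition st_path_from_to :: "(int \<times> nat) set \<Rightarrow> int \<times> nat \<Rightarrow> (int \<times> nat) list \<Rightarrow> bool" where
  "st_path_from_to A z p \<longleftrightarrow> st_path p \<and> hd p \<in> A \<and> last p = z"

definition diagonal_path :: "(int \<times> nat) list \<Rightarrow> bool" where
  "diagonal_path p \<longleftrightarrow> st_path p \<and>
    (\<forall>i. Suc i < length p \<longrightarrow> \<bar>fst (p ! Suc i) - fst (p ! i)\<bar> = 1)"

definition empty_path :: "(nat \<Rightarrow> int \<Rightarrow> nat) \<Rightarrow> (int \<times> nat) list \<Rightarrow> bool" where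
  "empty_path l p \<longleftrightarrow> st_path p \<and> (\<forall>(x, t) \<in> set p. l t x = 0)"

definition wide_path :: "(nat \<Rightarrow> int \<Rightarrow> nat) \<Rightarrow> (int \<times> nat) list \<Rightarrow> bool" where
  "wide_path l p \<longleftrightarrow> empty_path l p \<and>
    \<not> (\<exists>i x y t. Suc i < length p \<and> p ! i = (x, t) \<and> p ! Suc i = (y, t + 1) \<and>
        \<bar>x - y\<bar> = 1 \<and> l t y = 1 \<and> l (t + 1) x = 1)"

lemma prob_space_uniform_config: "prob_space uniform_config"
  unfolding uniform_config_def
  by (intro prob_space_PiM prob_space_uniform_count_measure) auto

lemma measurable_one_or_three [measurable]:
  "(\<lambda>w. one_or_three w t x) \<in> measurable uniform_config (count_space UNIV)"
proof (induction t arbitrary: x)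
  case 0
  have "(\<lambda>w. w x) \<in> measurable uniform_config (uniform_count_measure {0, 1})"
    unfolding uniform_config_def by (rule measurable_component_singleton) simp
  moreover have "id \<in> measurable (uniform_count_measure {0, 1 :: nat}) (count_space UNIV)"
    by (intro measurableI) (simp_all add: sets_uniform_count_measure space_uniform_count_measure)
  ultimately have "id \<circ> (\<lambda>w. w x) \<in> measurable uniform_config (count_space UNIV)"
    by (rule measurable_comp)
  then show ?case by (simp only: o_def id_apply one_or_three.simps)
next
  case (Suc t)
  note Suc.IH [measurable]
  show ?case unfolding one_or_three.simps by measurable
qed

text \<open>The events in question are measurable, so their \<^const>\<open>measure\<close> is not a default value.\<close>

lemma sets_empty_diagonal_path:
  "{w \<in> space uniform_config. \<exists>p. st_path_from_to A z p \<and> diagonal_path p \<and>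
      empty_path (one_or_three w) p} \<in> sets uniform_config"
proof -
  have *: "{w \<in> space uniform_config. st_path_from_to A z p \<and> diagonal_path p \<and>
      empty_path (one_or_three w) p} \<in> sets uniform_config" for p
    unfolding empty_path_def case_prod_beta by measurable
  show ?thesis
    by (rule sets.sets_Collect_countable_Ex) (rule *)
qed

lemma sets_wide_path:
  "{w \<in> space uniform_config. \<exists>p. st_path_from_to A z p \<and> wide_path (one_or_three w) p}
    \<in> sets uniform_config"
proof -
  have *: "{w \<in> space uniform_config. st_path_from_to A z p \<and>
      wide_path (one_or_three w) p} \<in> sets uniform_config" for p
    unfolding wide_path_def empty_path_def case_prod_beta by measurable
  show ?thesis
    by (rule sets.sets_Collect_countable_Ex) (rule *)
qed

end

theory Submission
  imports Defs "HOL-Real_Asymp.Real_Asymp"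
begin

text \<open>
  The value at \<open>(y, u)\<close> is a sum modulo 2 of initial values in \<open>[y - u, y + u]\<close> in which both end
  points occur. So it is a fair bit independent of every event that depends only on initial values
  in an interval that does not contain both \<open>y - u\<close> and \<open>y + u\<close>.

  \<^emph>\<open>Diagonal paths.\<close> Each step of a diagonal path reveals a new fair bit, and the \<open>2 ^ t\<close> paths just
  fail to give decay in the union bound. A rightmost path gains a factor: whenever it steps left
  and then right, the site opposite to this corner is occupied, so such a corner has probability
  \<open>1 / 8\<close> instead of \<open>1 / 4\<close>.

  \<^emph>\<open>Wide paths.\<close> A maximal run of zeros generates a triangle of zeros bounded by ones, which a wide
  path can leave only at the apex, and only if the run has odd length. The site above the apex
  is empty and lies in a new run, whose extents to the left and to the right are independent
  geometric variables \<open>k\<close> and \<open>r\<close>. The path survives only if \<open>k + r\<close> is even, and this gives a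
  renewal inequality with exponentially small solution.
\<close>

abbreviation ca :: "(int \<Rightarrow> nat) \<Rightarrow> nat \<Rightarrow> int \<Rightarrow> nat" where
  "ca \<equiv> one_or_three"

section \<open>Flipping one initial value: light cones and invariance of the measure\<close>

definition flip :: "int \<Rightarrow> (int \<Rightarrow> nat) \<Rightarrow> int \<Rightarrow> nat" where
  "flip k w = w(k := 1 - w k)"

lemma space_uniform_config: "space uniform_config = {w. \<forall>x. w x \<in> {0, 1}}"
  by (auto simp: uniform_config_def space_PiM PiE_def space_uniform_count_measure Pi_def)

lemma flip_in_space: "w \<in> space uniform_config \<Longrightarrow> flip k w \<in> space uniform_config"
  by (auto simp: space_uniform_config flip_def)

lemma ca_le_1: "w \<in> space uniform_config \<Longrightarrow> ca w t x \<le> 1"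
proof (induction t)
  case 0
  then have "w x \<in> {0, 1}" by (simp add: space_uniform_config)
  then show ?case by auto
qed (simp add: less_Suc_eq_le[symmetric])

lemma ca_flip_outside: "int t < \<bar>x - k\<bar> \<Longrightarrow> ca (flip k w) t x = ca w t x"
  by (induction t arbitrary: x) (auto simp: flip_def)

text \<open>On the boundary of the light cone of \<open>k\<close> exactly one of the three summands
  sees the flip, so the parity changes at every step.\<close>

lemma ca_flip_boundary:
  assumes "w \<in> space uniform_config" and "\<bar>x - k\<bar> = int t"
  shows "ca (flip k w) t x = 1 - ca w t x"
  using assms(2)
proof (induction t arbitrary: x)
  case 0
  then show ?case by (simp add: flip_def)
next
  case (Suc t)
  have parity: "(1 - a + b + c) mod 2 = 1 - (a + b + c) mod 2"
    "(c + b + (1 - a)) mod 2 = 1 - (c + b + a) mod 2" if "a \<le> 1" for a b c :: nat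
    using that by (cases "a = 0"; auto simp: mod2_eq_if)+
  consider "x - k = int (Suc t)" | "x - k = - int (Suc t)" using Suc.prems by linarith
  then show ?case
  proof cases
    case 1
    then have "ca (flip k w) t (x - 1) = 1 - ca w t (x - 1)" by (intro Suc.IH) simp
    moreover have "ca (flip k w) t x = ca w t x" "ca (flip k w) t (x + 1) = ca w t (x + 1)"
      using 1 by (intro ca_flip_outside; simp)+
    ultimately show ?thesis using parity(1)[OF ca_le_1[OF assms(1)]] by simp
  next
    case 2
    then have "ca (flip k w) t (x + 1) = 1 - ca w t (x + 1)" by (intro Suc.IH) simp
    moreover have "ca (flip k w) t x = ca w t x" "ca (flip k w) t (x - 1) = ca w t (x - 1)"
      using 2 by (intro ca_flip_outside; simp)+
    ultimately show ?thesis using parity(2)[OF ca_le_1[OF assms(1)]] by simp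
  qed
qed

lemma flip_measurable [measurable]: "flip k \<in> measurable uniform_config uniform_config"
proof -
  let ?U = "uniform_count_measure {0, 1 :: nat}"
  have comp: "(\<lambda>w. w i) \<in> measurable (Pi\<^sub>M UNIV (\<lambda>_. ?U)) ?U" for i :: int
    by (rule measurable_component_singleton) simp
  have "(\<lambda>v. 1 - v) \<in> measurable ?U ?U"
    by (intro measurableI) (auto simp: sets_uniform_count_measure space_uniform_count_measure)
  then have "(\<lambda>w. 1 - w k) \<in> measurable (Pi\<^sub>M UNIV (\<lambda>_. ?U)) ?U"
    by (rule measurable_compose[OF comp])
  then show ?thesis
    unfolding uniform_config_def
  proof (intro measurable_PiM_single')
    fix i :: int
    show "(\<lambda>w. flip k w i) \<in> measurable (Pi\<^sub>M UNIV (\<lambda>_. ?U)) ?U"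
      using \<open>(\<lambda>w. 1 - w k) \<in> _\<close> comp[of i] by (cases "i = k") (simp_all add: flip_def)
  qed (use flip_in_space[unfolded uniform_config_def space_PiM] in \<open>auto simp: space_PiM\<close>)
qed

text \<open>A product measure is determined by its values on cylinders. The preimage of a cylinder
  is a cylinder in which only the factor at \<open>k\<close> is reflected, and reflection keeps the
  cardinality.\<close>

lemma distr_flip: "distr uniform_config uniform_config (flip k) = uniform_config"
proof -
  let ?U = "uniform_count_measure {0, 1 :: nat}"
  interpret U: prob_space ?U by (rule prob_space_uniform_count_measure) auto
  interpret product_prob_space "\<lambda>_. ?U" "UNIV :: int set" ..
  have "distr uniform_config uniform_config (flip k) = Pi\<^sub>M UNIV (\<lambda>_. ?U)"
  proof (rule PiM_eq)
    fix J :: "int set" and F :: "int \<Rightarrow> nat set"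
    assume J: "finite J" and F: "\<And>j. j \<in> J \<Longrightarrow> F j \<in> sets ?U"
    define G where "G = (\<lambda>j. if j = k then {v \<in> {0, 1}. 1 - v \<in> F j} else F j)"
    have G: "j \<in> J \<Longrightarrow> G j \<in> sets ?U" for j
      using F by (auto simp: G_def sets_uniform_count_measure)
    have UG: "emeasure ?U (G j) = emeasure ?U (F j)" if "j \<in> J" for j
    proof (cases "j = k")
      case True
      have "F j \<subseteq> {0, 1}" using F[OF that] by (simp add: sets_uniform_count_measure)
      then have "G j = (\<lambda>v. 1 - v) ` F j"
        by (force simp: G_def True image_iff)
      moreover have "inj_on (\<lambda>v. 1 - v) (F j)"
        by (rule inj_on_subset[OF _ \<open>F j \<subseteq> {0, 1}\<close>]) (simp add: inj_on_def)
      ultimately have "card (G j) = card (F j)" by (simp add: card_image)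
      then show ?thesis using F[OF that] G[OF that]
        by (simp add: emeasure_uniform_count_measure sets_uniform_count_measure)
    qed (simp add: G_def)
    have "flip k -` prod_emb UNIV (\<lambda>_. ?U) J (Pi\<^sub>E J F) \<inter> space uniform_config =
      prod_emb UNIV (\<lambda>_. ?U) J (Pi\<^sub>E J G)"
    proof (intro set_eqI)
      fix w
      have "(\<forall>x. w x \<in> {0, 1}) \<Longrightarrow> restrict (flip k w) J \<in> Pi\<^sub>E J F \<longleftrightarrow> restrict w J \<in> Pi\<^sub>E J G"
        by (auto simp: G_def flip_def PiE_def Pi_def)
      then show "w \<in> flip k -` prod_emb UNIV (\<lambda>_. ?U) J (Pi\<^sub>E J F) \<inter> space uniform_config \<longleftrightarrow>
        w \<in> prod_emb UNIV (\<lambda>_. ?U) J (Pi\<^sub>E J G)"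
        using flip_in_space[of w k]
        by (auto simp: prod_emb_def space_uniform_config space_uniform_count_measure PiE_def Pi_def)
    qed
    moreover have "prod_emb UNIV (\<lambda>_. ?U) J (Pi\<^sub>E J F) \<in> sets uniform_config"
      unfolding uniform_config_def using J F by (intro sets_PiM_I) auto
    ultimately have "emeasure (distr uniform_config uniform_config (flip k))
        (prod_emb UNIV (\<lambda>_. ?U) J (Pi\<^sub>E J F)) =
      emeasure uniform_config (prod_emb UNIV (\<lambda>_. ?U) J (Pi\<^sub>E J G))"
      by (simp add: emeasure_distr)
    also have "\<dots> = (\<Prod>j\<in>J. emeasure ?U (G j))"
      unfolding uniform_config_def using J G by (intro emeasure_PiM_emb) auto
    also have "\<dots> = (\<Prod>j\<in>J. emeasure ?U (F j))" by (intro prod.cong UG refl)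
    finally show "emeasure (distr uniform_config uniform_config (flip k))
        (prod_emb UNIV (\<lambda>_. ?U) J (Pi\<^sub>E J F)) = (\<Prod>j\<in>J. emeasure ?U (F j))" .
  qed (simp add: uniform_config_def)
  then show ?thesis by (simp add: uniform_config_def)
qed

section \<open>Events that depend on the initial values in an interval, and fresh bits\<close>

interpretation uc: prob_space uniform_config
  by (rule prob_space_uniform_config)

text \<open>Dependence on the interval is expressed by invariance under single flips outside it,
  which is all that the symmetry argument needs. If \<open>b < a\<close>, every flip is
  covered.\<close>

definition localized :: "int \<Rightarrow> int \<Rightarrow> (int \<Rightarrow> nat) set \<Rightarrow> bool" where
  "localized a b S \<longleftrightarrow> S \<in> sets uniform_config \<and>
    (\<forall>w \<in> space uniform_config. \<forall>k. k < a \<or> b < k \<longrightarrow> (flip k w \<in> S \<longleftrightarrow> w \<in> S))"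

lemma localized_sets: "localized a b S \<Longrightarrow> S \<in> sets uniform_config"
  by (simp add: localized_def)

lemma localized_mono: "localized a b S \<Longrightarrow> a' \<le> a \<Longrightarrow> b \<le> b' \<Longrightarrow> localized a' b' S"
  by (force simp: localized_def)

lemma localized_space: "localized a b (space uniform_config)"
  by (auto simp: localized_def flip_in_space)

lemma localized_Int_ca:
  assumes "localized a b S" "a \<le> y - int u" "y + int u \<le> b"
  shows "localized a b (S \<inter> {w \<in> space uniform_config. ca w u y = v})"
  using assms by (auto simp: localized_def flip_in_space ca_flip_outside)

text \<open>Flipping an end point of \<open>[y - u, y + u]\<close> that lies outside
  \<open>[a, b]\<close> keeps the measure and \<open>S\<close> but exchanges the values 0 and 1 at
  \<open>(y, u)\<close>, so these two parts of \<open>S\<close> have equal measure.\<close>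

lemma measure_Int_ca:
  assumes loc: "localized a b S" and out: "y - int u < a \<or> b < y + int u" and "v \<le> 1"
  shows "measure uniform_config (S \<inter> {w \<in> space uniform_config. ca w u y = v}) =
    measure uniform_config S / 2"
proof -
  obtain k where k: "\<bar>y - k\<bar> = int u" "k < a \<or> b < k"
    using out that[of "y - int u"] that[of "y + int u"] by auto
  let ?S = "\<lambda>v. S \<inter> {w \<in> space uniform_config. ca w u y = v}"
  note [measurable] = localized_sets[OF loc]
  have ms: "?S v \<in> sets uniform_config" for v by measurable
  have "flip k -` ?S 0 \<inter> space uniform_config = ?S 1"
  proof (intro set_eqI)
    fix w
    show "w \<in> flip k -` ?S 0 \<inter> space uniform_config \<longleftrightarrow> w \<in> ?S 1"
      using loc k flip_in_space[of w k] ca_flip_boundary[OF _ k(1), of w] ca_le_1[of w u y]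
      by (cases "w \<in> space uniform_config") (auto simp: localized_def)
  qed
  then have "measure uniform_config (?S 0) = measure uniform_config (?S 1)"
    using measure_distr[OF flip_measurable, of "?S 0" k] ms by (simp add: distr_flip)
  moreover have "measure uniform_config S = measure uniform_config (?S 0) + measure uniform_config (?S 1)"
  proof -
    have "S = ?S 0 \<union> ?S 1"
      using sets.sets_into_space[OF localized_sets[OF loc]] ca_le_1[of _ u y]
      by (auto simp: le_Suc_eq subset_eq)
    then have "measure uniform_config S = measure uniform_config (?S 0 \<union> ?S 1)" by simp
    also have "\<dots> = measure uniform_config (?S 0) + measure uniform_config (?S 1)"
      using ms by (intro uc.finite_measure_Union) auto
    finally show ?thesis .
  qed
  moreover have "v = 0 \<or> v = 1" using \<open>v \<le> 1\<close> by auto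
  ultimately show ?thesis by auto
qed

text \<open>Sites are revealed from left to right. The dependence interval of each sticks out of the
  known interval by one site on the right, so each prescribed value halves the measure.\<close>

lemma constraints_right:
  assumes "localized a (y + int u) S" "a \<le> y + 1 - int u" "\<And>j. v j \<le> 1"
  defines "T \<equiv> \<lambda>r. S \<inter> {w \<in> space uniform_config. \<forall>j\<in>{1..r}. ca w u (y + int j) = v j}"
  shows "localized a (y + int u + int r) (T r) \<and>
    measure uniform_config (T r) = measure uniform_config S / 2 ^ r"
proof (induction r)
  case 0
  have "T 0 = S" using sets.sets_into_space[OF localized_sets[OF assms(1)]] by (auto simp: T_def)
  then show ?case using assms by simp
next
  case (Suc r)
  have T: "T (Suc r) = T r \<inter> {w \<in> space uniform_config. ca w u (y + int (Suc r)) = v (Suc r)}"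
    by (auto simp: T_def atLeastAtMostSuc_conv simp del: of_nat_Suc)
  have "localized a (y + int u + int (Suc r)) (T (Suc r))"
    unfolding T using Suc assms(2) by (intro localized_Int_ca) (auto intro: localized_mono)
  moreover have "measure uniform_config (T (Suc r)) = measure uniform_config (T r) / 2"
    unfolding T using Suc assms(3) by (intro measure_Int_ca[of a "y + int u + int r"]) auto
  ultimately show ?case using Suc by simp
qed

text \<open>Mirror image of \<open>constraints_right\<close>.\<close>

lemma constraints_left:
  assumes "localized (y - int u) b S" "y - 1 + int u \<le> b" "\<And>j. v j \<le> 1"
  defines "T \<equiv> \<lambda>r. S \<inter> {w \<in> space uniform_config. \<forall>j\<in>{1..r}. ca w u (y - int j) = v j}"
  shows "localized (y - int u - int r) b (T r) \<and>
    measure uniform_config (T r) = measure uniform_config S / 2 ^ r"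
proof (induction r)
  case 0
  have "T 0 = S" using sets.sets_into_space[OF localized_sets[OF assms(1)]] by (auto simp: T_def)
  then show ?case using assms by simp
next
  case (Suc r)
  have T: "T (Suc r) = T r \<inter> {w \<in> space uniform_config. ca w u (y - int (Suc r)) = v (Suc r)}"
    by (auto simp: T_def atLeastAtMostSuc_conv simp del: of_nat_Suc)
  have "localized (y - int u - int (Suc r)) b (T (Suc r))"
    unfolding T using Suc assms(2) by (intro localized_Int_ca) (auto intro: localized_mono)
  moreover have "measure uniform_config (T (Suc r)) = measure uniform_config (T r) / 2"
    unfolding T using Suc assms(3) by (intro measure_Int_ca[of "y - int u - int r" b]) auto
  ultimately show ?case using Suc by simp
qed

section \<open>Wide paths inside triangles of zeros\<close>

definition wide_steps :: "(nat \<Rightarrow> int \<Rightarrow> nat) \<Rightarrow> nat \<Rightarrow> int list \<Rightarrow> bool" where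
  "wide_steps l u p \<longleftrightarrow> (\<forall>i<length p. l (u + i) (p ! i) = 0) \<and>
    (\<forall>i. Suc i < length p \<longrightarrow> \<bar>p ! Suc i - p ! i\<bar> \<le> 1 \<and>
      \<not> (\<bar>p ! Suc i - p ! i\<bar> = 1 \<and> l (u + i) (p ! Suc i) = 1 \<and> l (u + Suc i) (p ! i) = 1))"

lemma wide_steps_drop: "wide_steps l u p \<Longrightarrow> wide_steps l (u + k) (drop k p)"
proof -
  assume p: "wide_steps l u p"
  have "k + i < length p \<Longrightarrow> l (u + (k + i)) (p ! (k + i)) = 0"
    "Suc (k + i) < length p \<Longrightarrow> \<bar>p ! Suc (k + i) - p ! (k + i)\<bar> \<le> 1 \<and>
      \<not> (\<bar>p ! Suc (k + i) - p ! (k + i)\<bar> = 1 \<and> l (u + (k + i)) (p ! Suc (k + i)) = 1 \<and>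
        l (u + Suc (k + i)) (p ! (k + i)) = 1)" for i
    using p unfolding wide_steps_def by metis+
  then show ?thesis by (simp add: wide_steps_def less_diff_conv2 add.assoc)
qed

text \<open>While a row of zeros has more than one site, each end site sees exactly one 1 and turns
  into 1. So the row shrinks by one site on each side and stays enclosed by ones.\<close>

lemma triangle:
  assumes rule: "\<And>t x. l (Suc t) x = (l t (x - 1) + l t x + l t (x + 1)) mod (2::nat)"
    and base: "\<And>z. a \<le> z \<Longrightarrow> z \<le> b \<Longrightarrow> l u z = 0" "l u (a - 1) = 1" "l u (b + 1) = 1"
    and "2 * int i \<le> b - a"
  shows "(\<forall>z\<in>{a + int i..b - int i}. l (u + i) z = 0) \<and>
    l (u + i) (a + int i - 1) = 1 \<and> l (u + i) (b - int i + 1) = 1"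
  using assms(5)
proof (induction i)
  case 0
  then show ?case using base by auto
next
  case (Suc i)
  then have IH: "\<And>z. a + int i \<le> z \<Longrightarrow> z \<le> b - int i \<Longrightarrow> l (u + i) z = 0"
    "l (u + i) (a + int i - 1) = 1" "l (u + i) (b - int i + 1) = 1" by auto
  have "l (u + Suc i) z = 0" if "z \<in> {a + int (Suc i)..b - int (Suc i)}" for z
    using that by (simp add: rule IH(1))
  moreover have "l (u + Suc i) (a + int i) = 1" "l (u + Suc i) (b - int i) = 1"
    using Suc.prems IH by (simp_all add: rule)
  ultimately show ?case by (simp add: algebra_simps)
qed

text \<open>An empty path cannot step onto the occupied sides of the triangle, and a diagonal step
  across a side passes between two ones, which wideness forbids. For a run of even length the bound
  on \<open>i\<close> also admits the row just beyond the tip, where the interval is empty: no wide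
  path lives that long.\<close>

lemma wide_steps_in_triangle:
  assumes rule: "\<And>t x. l (Suc t) x = (l t (x - 1) + l t x + l t (x + 1)) mod (2::nat)"
    and base: "\<And>z. a \<le> z \<Longrightarrow> z \<le> b \<Longrightarrow> l u z = 0" "l u (a - 1) = 1" "l u (b + 1) = 1"
    and p: "wide_steps l u p" "p ! 0 \<in> {a..b}"
    and "i < length p" "2 * int i < b - a + 2"
  shows "p ! i \<in> {a + int i..b - int i}"
  using assms(7,8)
proof (induction i)
  case 0
  then show ?case using p by simp
next
  case (Suc i)
  note T = triangle[of l a b u i, OF rule base]
  have row: "\<And>z. a + int i \<le> z \<Longrightarrow> z \<le> b - int i \<Longrightarrow> l (u + i) z = 0"
    "l (u + i) (a + int i - 1) = 1" "l (u + i) (b - int i + 1) = 1"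
    using T Suc.prems by auto
  have next_row: "l (u + Suc i) (a + int i) = 1" "l (u + Suc i) (b - int i) = 1"
    using Suc.prems row by (simp_all add: rule)
  have pi: "p ! i \<in> {a + int i..b - int i}" using Suc by simp
  have zero: "l (u + Suc i) (p ! Suc i) = 0"
    using p(1) Suc.prems unfolding wide_steps_def by (metis)
  have step: "\<bar>p ! Suc i - p ! i\<bar> \<le> 1"
    "\<not> (\<bar>p ! Suc i - p ! i\<bar> = 1 \<and> l (u + i) (p ! Suc i) = 1 \<and> l (u + Suc i) (p ! i) = 1)"
    using p(1) Suc.prems unfolding wide_steps_def by metis+
  have "p ! Suc i \<noteq> a + int i" "p ! Suc i \<noteq> b - int i"
    using zero next_row by auto
  moreover have "p ! Suc i \<noteq> a + int i - 1"
  proof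
    assume *: "p ! Suc i = a + int i - 1"
    then have "p ! i = a + int i" using pi step(1) by auto
    then show False using * step(2) row(2) next_row(1) by simp
  qed
  moreover have "p ! Suc i \<noteq> b - int i + 1"
  proof
    assume *: "p ! Suc i = b - int i + 1"
    then have "p ! i = b - int i" using pi step(1) by auto
    then show False using * step(2) row(3) next_row(2) by simp
  qed
  ultimately show ?case using pi step(1) by auto
qed

text \<open>
  A wide path can leave the apex of a triangle diagonally, so the starting point is only pinned
  down up to the maximal run of zeros that contains it.
\<close>

definition wide_from :: "nat \<Rightarrow> nat \<Rightarrow> int \<Rightarrow> (int \<Rightarrow> nat) \<Rightarrow> bool" where
  "wide_from n u x w \<longleftrightarrow> (\<exists>p. length p = Suc n \<and> wide_steps (ca w) u p \<and>
    (\<forall>z. min x (p ! 0) \<le> z \<and> z \<le> max x (p ! 0) \<longrightarrow> ca w u z = 0))"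

lemma sets_wide_from [measurable]: "{w \<in> space uniform_config. wide_from n u x w} \<in> sets uniform_config"
  unfolding wide_from_def wide_steps_def by measurable

text \<open>The run of zeros around \<open>x\<close> is explored to the left and then to the right.
  Either it fills a window of \<open>2 * n + 1\<close> sites, or both its ends are met; then its
  length must be odd, and the path passes the apex and restarts in the next row.\<close>

lemma wide_from_cases:
  assumes w: "w \<in> space uniform_config" and wide: "wide_from n u x w"
  obtains (long) a where "a \<le> 2 * n" "\<And>z. x - int a \<le> z \<Longrightarrow> z \<le> x + int (2 * n - a) \<Longrightarrow> ca w u z = 0"
  | (apex) m k where "m < n" "k \<le> 2 * m"
    "\<And>z. x - int k \<le> z \<Longrightarrow> z \<le> x + int (2 * m - k) \<Longrightarrow> ca w u z = 0"
    "ca w u (x - int k - 1) = 1" "ca w u (x + int (2 * m - k) + 1) = 1"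
    "wide_from (n - Suc m) (u + Suc m) (x + int m - int k) w"
proof -
  obtain p where p: "length p = Suc n" "wide_steps (ca w) u p"
    and seg: "\<And>z. min x (p ! 0) \<le> z \<Longrightarrow> z \<le> max x (p ! 0) \<Longrightarrow> ca w u z = 0"
    using wide unfolding wide_from_def by auto
  have x0: "ca w u x = 0" by (rule seg) auto
  have one: "ca w u z = 1" if "ca w u z \<noteq> 0" for z
    using that ca_le_1[OF w, of u z] by simp
  show thesis
  proof (cases "\<exists>k\<le>2 * n. ca w u (x - int k - 1) \<noteq> 0")
    case False
    then have all0: "ca w u (x - int k - 1) = 0" if "k \<le> 2 * n" for k using that by blast
    show thesis
    \<comment> \<open>No site among the nearest \<open>2 * n + 1\<close> on the left is occupied, so
      the window may lie entirely to the left of \<open>x\<close>.\<close>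
    proof (rule long[of "2 * n"])
      fix z assume z: "x - int (2 * n) \<le> z" "z \<le> x + int (2 * n - 2 * n)"
      show "ca w u z = 0"
      proof (cases "z = x")
        case False
        then show ?thesis using z all0[of "nat (x - z - 1)"] by (simp add: nat_le_iff)
      qed (simp add: x0)
    qed simp
  next
    case True
    define k where "k = (LEAST k. ca w u (x - int k - 1) \<noteq> 0)"
    obtain k0 where k0: "k0 \<le> 2 * n" "ca w u (x - int k0 - 1) \<noteq> 0" using True by auto
    have k1: "ca w u (x - int k - 1) = 1"
      unfolding k_def by (rule one) (rule LeastI, rule k0(2))
    have kn: "k \<le> 2 * n" unfolding k_def using k0(1) by (rule order_trans[OF Least_le, rotated]) (rule k0(2))
    have left: "ca w u z = 0" if "x - int k \<le> z" "z \<le> x" for z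
    proof (cases "z = x")
      case False
      then have "nat (x - z - 1) < k" "int (nat (x - z - 1)) = x - z - 1" using that by auto
      then show ?thesis unfolding k_def using not_less_Least[of "nat (x - z - 1)"] by force
    qed (simp add: x0)
    show thesis
    proof (cases "\<exists>r<2 * n - k. ca w u (x + int r + 1) \<noteq> 0")
      case False
      then have all0: "ca w u (x + int r + 1) = 0" if "r < 2 * n - k" for r using that by blast
      show thesis
      proof (rule long[OF kn])
        fix z assume z: "x - int k \<le> z" "z \<le> x + int (2 * n - k)"
        show "ca w u z = 0"
        proof (cases "z \<le> x")
          case False
          then have "nat (z - x - 1) < 2 * n - k" "int (nat (z - x - 1)) = z - x - 1" using z by auto
          then show ?thesis using all0[of "nat (z - x - 1)"] by simp
        qed (use left z in simp)
      qed
    next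
      case True
      define r where "r = (LEAST r. ca w u (x + int r + 1) \<noteq> 0)"
      obtain r0 where r0: "r0 < 2 * n - k" "ca w u (x + int r0 + 1) \<noteq> 0" using True by auto
      have r1: "ca w u (x + int r + 1) = 1"
        unfolding r_def by (rule one) (rule LeastI, rule r0(2))
      have rn: "r < 2 * n - k" unfolding r_def using r0(1)
        by (rule le_less_trans[OF Least_le, rotated]) (rule r0(2))
      have run: "ca w u z = 0" if "x - int k \<le> z" "z \<le> x + int r" for z
      proof (cases "z \<le> x")
        case False
        then have "nat (z - x - 1) < r" "int (nat (z - x - 1)) = z - x - 1" using that by auto
        then show ?thesis unfolding r_def using not_less_Least[of "nat (z - x - 1)"] by force
      qed (use left that in simp)
      have "p ! 0 \<noteq> x - int k - 1" "p ! 0 \<noteq> x + int r + 1"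
        using seg[of "p ! 0"] k1 r1 by auto
      have p0: "p ! 0 \<in> {x - int k..x + int r}"
      proof (rule ccontr)
        assume "\<not> ?thesis"
        then have "p ! 0 \<le> x - int k - 1 \<or> p ! 0 \<ge> x + int r + 1" by auto
        then show False using seg[of "x - int k - 1"] seg[of "x + int r + 1"] k1 r1 by auto
      qed
      have inside: "p ! i \<in> {x - int k + int i..x + int r - int i}"
        if "i \<le> n" "2 * int i < int k + int r + 2" for i
        by (rule wide_steps_in_triangle[of "ca w", OF _ run _ _ p(2) p0])
          (use k1 r1 p(1) that in auto)
      show thesis
      proof (cases "even (k + r)")
        case False
        then obtain m where m: "k + r = 2 * m + 1" by (rule oddE)
        then have "Suc m \<le> n" using rn kn by auto
        \<comment> \<open>For a run of even length this interval is empty, which is the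
          contradiction.\<close>
        then have "p ! Suc m \<in> {x - int k + int (Suc m)..x + int r - int (Suc m)}"
          using m by (intro inside) auto
        then show thesis using m by auto
      next
        case True
        then obtain m where m: "k + r = 2 * m" by (rule evenE)
        have mn: "m < n" and km: "k \<le> 2 * m" and r: "r = 2 * m - k" using rn m by auto
        define y where "y = x + int m - int k"
        have pm: "p ! m = y" using inside[of m] mn m by (auto simp: y_def)
        have y: "x - int k + int m = y" "x + int r - int m = y"
          using m by (auto simp: y_def)
        have row: "ca w (u + m) y = 0" "ca w (u + m) (y - 1) = 1" "ca w (u + m) (y + 1) = 1"
          using triangle[of "ca w" "x - int k" "x + int r" u m, OF _ run] k1 r1 m
          unfolding y by auto
        \<comment> \<open>The apex is a zero between two ones, so the site above it is empty. Hence
          that site shares a run with the next point of the path even after a diagonal step.\<close>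
        have apex0: "ca w (u + Suc m) y = 0" using row by simp
        have pS: "\<bar>p ! Suc m - y\<bar> \<le> 1" "ca w (u + Suc m) (p ! Suc m) = 0"
          using p mn unfolding wide_steps_def pm[symmetric] by (metis Suc_less_eq, metis Suc_less_eq)
        have "wide_from (n - Suc m) (u + Suc m) y w"
          unfolding wide_from_def
        proof (intro exI[of _ "drop (Suc m) p"] conjI allI impI)
          show "wide_steps (ca w) (u + Suc m) (drop (Suc m) p)" by (rule wide_steps_drop[OF p(2)])
          fix z assume "min y (drop (Suc m) p ! 0) \<le> z \<and> z \<le> max y (drop (Suc m) p ! 0)"
          then have "z = y \<or> z = p ! Suc m" using pS(1) p(1) mn by (auto simp: min_def max_def split: if_splits)
          then show "ca w (u + Suc m) z = 0" using apex0 pS(2) by auto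
        qed (use p(1) mn in simp)
        then show thesis
          using mn km run k1 r1 by (intro apex[of m k]) (auto simp: r y_def)
      qed
    qed
  qed
qed

section \<open>The renewal inequality for wide paths\<close>

lemma constraints_both:
  fixes r k :: nat
  assumes S: "localized (x - int u) (x + int u) S" and v: "\<And>j. v j \<le> 1" "\<And>j. v' j \<le> 1"
  defines "T \<equiv> S \<inter> {w \<in> space uniform_config. \<forall>j\<in>{1..r}. ca w u (x + int j) = v j}
    \<inter> {w \<in> space uniform_config. \<forall>j\<in>{1..k}. ca w u (x - int j) = v' j}"
  shows "localized (x - int u - int k) (x + int u + int r) T"
    and "measure uniform_config T = measure uniform_config S / 2 ^ (r + k)"
proof -
  have "localized (x - int u) (x + int u + int r)
      (S \<inter> {w \<in> space uniform_config. \<forall>j\<in>{1..r}. ca w u (x + int j) = v j}) \<and>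
    measure uniform_config (S \<inter> {w \<in> space uniform_config. \<forall>j\<in>{1..r}. ca w u (x + int j) = v j}) =
      measure uniform_config S / 2 ^ r"
    using S v by (intro constraints_right) auto
  then show "localized (x - int u - int k) (x + int u + int r) T"
    "measure uniform_config T = measure uniform_config S / 2 ^ (r + k)"
    using constraints_left[of x u "x + int u + int r" _ v' k] v
    unfolding T_def by (auto simp: power_add)
qed

text \<open>The weight of \<open>m\<close> counts \<open>2 * m + 1\<close> positions of the run
  relative to \<open>x\<close>, each prescribing \<open>2 * m\<close> zeros and two ones. The rate
  3/4 is the one for which the weights divided by \<open>(3 / 4) ^ Suc m\<close> sum to 1 over all
  \<open>m\<close>.\<close>

lemma wide_generating_sum:
  "(\<Sum>m<n. real (2 * m + 1) / 4 ^ Suc m * (3 / 4) ^ (n - Suc m)) = (3 / 4) ^ n - real (n + 1) / 4 ^ n"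
proof (induction n)
  case (Suc n)
  have "(\<Sum>m<n. real (2 * m + 1) / 4 ^ Suc m * (3 / 4) ^ (Suc n - Suc m)) =
    (\<Sum>m<n. 3 / 4 * (real (2 * m + 1) / 4 ^ Suc m * (3 / 4) ^ (n - Suc m)))"
  proof (intro sum.cong refl)
    fix m assume "m \<in> {..<n}"
    then have "Suc n - Suc m = Suc (n - Suc m)" by auto
    then show "real (2 * m + 1) / 4 ^ Suc m * (3 / 4) ^ (Suc n - Suc m) =
      3 / 4 * (real (2 * m + 1) / 4 ^ Suc m * (3 / 4) ^ (n - Suc m))" by simp
  qed
  also have "\<dots> = 3 / 4 * ((3 / 4) ^ n - real (n + 1) / 4 ^ n)"
    by (simp only: sum_distrib_left[symmetric] Suc.IH)
  finally show ?case by (simp add: field_simps)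
qed simp

text \<open>The event \<open>S\<close> carries what is already known, so that the induction can
  restart at an apex: after a run has been revealed, the known interval is exactly the dependence
  interval of the site above the apex.\<close>

lemma measure_wide_from:
  assumes "localized (x - int u) (x + int u) S"
  shows "measure uniform_config (S \<inter> {w \<in> space uniform_config. wide_from n u x w})
    \<le> 2 * (3 / 4) ^ n * measure uniform_config S"
  using assms
proof (induction n arbitrary: u x S rule: less_induct)
  case (less n)
  let ?P = "measure uniform_config" and ?sp = "space uniform_config"
  let ?R = "\<lambda>r v. {w \<in> ?sp. \<forall>j\<in>{1..r}. ca w u (x + int j) = v j}"
  let ?L = "\<lambda>k v. {w \<in> ?sp. \<forall>j\<in>{1..k}. ca w u (x - int j) = v j}"
  let ?W = "\<lambda>n u x. {w \<in> ?sp. wide_from n u x w}"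
  \<comment> \<open>Neither \<open>Z\<close> nor \<open>E\<close> adds a condition on the site
    \<open>x\<close>, whose value \<open>S\<close> may already determine. The remaining sites give
    the exponents \<open>2 * n\<close> and \<open>2 * m + 2\<close> of 1/2.\<close>
  define Z where "Z = (\<lambda>a. S \<inter> ?R (2 * n - a) (\<lambda>_. 0) \<inter> ?L a (\<lambda>_. 0))"
  define E where "E = (\<lambda>m k. S \<inter> ?R (Suc (2 * m - k)) (\<lambda>j. if j = Suc (2 * m - k) then 1 else 0)
    \<inter> ?L (Suc k) (\<lambda>j. if j = Suc k then 1 else 0))"
  define F where "F = (\<lambda>m k. E m k \<inter> ?W (n - Suc m) (u + Suc m) (x + int m - int k))"
  note [measurable] = localized_sets[OF less.prems]
  have Zs: "Z a \<in> sets uniform_config" for a unfolding Z_def by measurable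
  have Es [measurable]: "E m k \<in> sets uniform_config" for m k unfolding E_def by measurable
  have Fs: "F m k \<in> sets uniform_config" for m k unfolding F_def by measurable
  have sub: "S \<inter> ?W n u x \<subseteq> (\<Union>a\<le>2 * n. Z a) \<union> (\<Union>m<n. \<Union>k\<le>2 * m. F m k)"
  proof
    fix w assume "w \<in> S \<inter> ?W n u x"
    then have w: "w \<in> S" "w \<in> ?sp" "wide_from n u x w" by auto
    from w(2,3) show "w \<in> (\<Union>a\<le>2 * n. Z a) \<union> (\<Union>m<n. \<Union>k\<le>2 * m. F m k)"
    proof (cases rule: wide_from_cases)
      case (long a)
      then have "w \<in> Z a" using w by (auto simp: Z_def)
      then show ?thesis using long(1) by auto
    next
      case (apex m k)
      have "ca w u (x - int j) = 0" if "j \<le> k" for j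
        using apex(3)[of "x - int j"] that by simp
      moreover have "ca w u (x + int j) = 0" if "j \<le> 2 * m - k" for j
        using apex(3)[of "x + int j"] that by simp
      ultimately have "w \<in> F m k"
        using w apex(4-6) by (auto simp: F_def E_def le_Suc_eq algebra_simps)
      then show ?thesis using apex(1,2) by auto
    qed
  qed
  have PZ: "?P (Z a) = ?P S / 4 ^ n" if "a \<le> 2 * n" for a
  proof -
    have "?P (Z a) = ?P S / 2 ^ (2 * n - a + a)"
      unfolding Z_def by (rule constraints_both(2)[OF less.prems]) auto
    then show ?thesis using that by (simp add: power_mult)
  qed
  have PF: "?P (F m k) \<le> 2 * (3 / 4) ^ (n - Suc m) * (?P S / 4 ^ Suc m)" if "m < n" "k \<le> 2 * m" for m k
  proof -
    have "localized (x - int u - int (Suc k)) (x + int u + int (Suc (2 * m - k))) (E m k)"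
      unfolding E_def by (rule constraints_both(1)[OF less.prems]) auto
    then have "localized (x + int m - int k - int (u + Suc m)) (x + int m - int k + int (u + Suc m)) (E m k)"
      using that(2) by (simp add: algebra_simps of_nat_diff)
    then have "?P (F m k) \<le> 2 * (3 / 4) ^ (n - Suc m) * ?P (E m k)"
      unfolding F_def using that(1) by (intro less.IH) auto
    moreover have "?P (E m k) = ?P S / 2 ^ (Suc (2 * m - k) + Suc k)"
      unfolding E_def by (rule constraints_both(2)[OF less.prems]) auto
    moreover have "Suc (2 * m - k) + Suc k = 2 * Suc m" using that(2) by simp
    ultimately show ?thesis by (simp add: power_mult)
  qed
  have "?P (S \<inter> ?W n u x) \<le> ?P ((\<Union>a\<le>2 * n. Z a) \<union> (\<Union>m<n. \<Union>k\<le>2 * m. F m k))"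
    using Zs Fs by (intro uc.finite_measure_mono[OF sub]) auto
  also have "\<dots> \<le> ?P (\<Union>a\<le>2 * n. Z a) + ?P (\<Union>m<n. \<Union>k\<le>2 * m. F m k)"
    using Zs Fs by (intro measure_Un_le) auto
  also have "\<dots> \<le> (\<Sum>a\<le>2 * n. ?P (Z a)) + (\<Sum>m<n. \<Sum>k\<le>2 * m. ?P (F m k))"
    using Zs Fs
    by (intro add_mono uc.finite_measure_subadditive_finite order_trans[OF uc.finite_measure_subadditive_finite] sum_mono) auto
  also have "\<dots> \<le> (\<Sum>a\<le>2 * n. ?P S / 4 ^ n) +
      (\<Sum>m<n. \<Sum>k\<le>2 * m. 2 * (3 / 4) ^ (n - Suc m) * (?P S / 4 ^ Suc m))"
    by (intro add_mono sum_mono) (use PZ PF in auto)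
  also have "\<dots> = real (2 * n + 1) * (?P S / 4 ^ n) +
      2 * ?P S * (\<Sum>m<n. real (2 * m + 1) / 4 ^ Suc m * (3 / 4) ^ (n - Suc m))"
    by (simp add: sum_distrib_left mult_ac)
  \<comment> \<open>Twice the subtracted term of the closed form,
    \<open>2 * (n + 1) / 4 ^ n\<close>, absorbs the contribution \<open>(2 * n + 1) / 4 ^ n\<close>
    of the windows.\<close>
  also have "\<dots> \<le> 2 * (3 / 4) ^ n * ?P S"
    unfolding wide_generating_sum by (simp add: field_simps)
  finally show ?case .
qed

section \<open>Rightmost diagonal paths and their corners\<close>

definition diag_steps :: "(nat \<Rightarrow> int \<Rightarrow> nat) \<Rightarrow> nat \<Rightarrow> int list \<Rightarrow> bool" where
  "diag_steps l s p \<longleftrightarrow> (\<forall>i<length p. l (s + i) (p ! i) = 0) \<and>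
    (\<forall>i. Suc i < length p \<longrightarrow> \<bar>p ! Suc i - p ! i\<bar> = 1)"

text \<open>
  Turning a corner that goes left and then right into one that goes right and then left moves the
  path to the right. In a rightmost path this is impossible, so the site opposite to the corner
  is occupied.
\<close>

definition blocked_corners :: "(nat \<Rightarrow> int \<Rightarrow> nat) \<Rightarrow> nat \<Rightarrow> int list \<Rightarrow> bool" where
  "blocked_corners l s p \<longleftrightarrow> (\<forall>i. Suc (Suc i) < length p \<longrightarrow>
    p ! Suc i = p ! i - 1 \<longrightarrow> p ! Suc (Suc i) = p ! i \<longrightarrow> l (s + Suc i) (p ! i + 1) \<noteq> 0)"

lemma diag_steps_take: "diag_steps l s p \<Longrightarrow> diag_steps l s (take k p)"
  by (auto simp: diag_steps_def)

lemma diag_steps_drop: "diag_steps l s p \<Longrightarrow> diag_steps l (s + k) (drop k p)"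
proof -
  assume p: "diag_steps l s p"
  have "k + i < length p \<Longrightarrow> l (s + (k + i)) (p ! (k + i)) = 0"
    "Suc (k + i) < length p \<Longrightarrow> \<bar>p ! Suc (k + i) - p ! (k + i)\<bar> = 1" for i
    using p unfolding diag_steps_def by metis+
  then show ?thesis by (simp add: diag_steps_def less_diff_conv2 add.assoc)
qed

lemma blocked_corners_drop: "blocked_corners l s p \<Longrightarrow> blocked_corners l (s + k) (drop k p)"
proof -
  assume p: "blocked_corners l s p"
  have "Suc (Suc (k + i)) < length p \<Longrightarrow> p ! Suc (k + i) = p ! (k + i) - 1 \<Longrightarrow>
    p ! Suc (Suc (k + i)) = p ! (k + i) \<Longrightarrow> l (s + Suc (k + i)) (p ! (k + i) + 1) \<noteq> 0" for i
    using p unfolding blocked_corners_def by metis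
  then show ?thesis by (simp add: blocked_corners_def less_diff_conv2 add.assoc)
qed

lemma diag_steps_snoc:
  assumes "diag_steps l 0 p" "length p = Suc s" "\<bar>x - p ! s\<bar> = 1" "l (Suc s) x = 0"
  shows "diag_steps l 0 (p @ [x])"
  using assms by (auto simp: diag_steps_def nth_append less_Suc_eq)

text \<open>Going backwards in time, the path greedily prefers the right one of the reachable predecessors.\<close>

lemma ex_blocked_corners:
  assumes "diag_steps l 0 p" "length p = Suc s" "p ! s = x"
  shows "\<exists>q. diag_steps l 0 q \<and> blocked_corners l 0 q \<and> length q = Suc s \<and> q ! s = x"
  using assms
proof (induction s arbitrary: p x)
  case 0
  then show ?case by (intro exI[of _ p]) (auto simp: blocked_corners_def)
next
  case (Suc s)
  define reach where "reach = (\<lambda>y. \<exists>q. diag_steps l 0 q \<and> length q = Suc s \<and> q ! s = y)"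
  define y where "y = (if reach (x + 1) then x + 1 else x - 1)"
  have x0: "l (Suc s) x = 0" using Suc.prems unfolding diag_steps_def by auto
  have "reach (p ! s)"
    unfolding reach_def using Suc.prems by (intro exI[of _ "take (Suc s) p"]) (auto intro: diag_steps_take)
  moreover have "\<bar>x - p ! s\<bar> = 1" using Suc.prems unfolding diag_steps_def by auto
  then have "p ! s = x + 1 \<or> p ! s = x - 1" by auto
  ultimately have "reach y" by (auto simp: y_def)
  then obtain q where q: "diag_steps l 0 q" "blocked_corners l 0 q" "length q = Suc s" "q ! s = y"
    using Suc.IH unfolding reach_def by blast
  have corner: "l s (x + 1) \<noteq> 0" if s: "s = Suc r" and "q ! r = x" and "y = x - 1" for r
  proof
    \<comment> \<open>If this site were empty, the path could be rerouted through it, and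
      \<open>x + 1\<close> would be reachable, against the choice of \<open>y\<close>.\<close>
    assume "l s (x + 1) = 0"
    have "diag_steps l 0 (take s q @ [x + 1])"
      by (rule diag_steps_snoc[where s = r])
        (use s q \<open>q ! r = x\<close> \<open>l s (x + 1) = 0\<close> in \<open>auto intro: diag_steps_take\<close>)
    then have "reach (x + 1)"
      unfolding reach_def using q(3) by (intro exI[of _ "take s q @ [x + 1]"]) (auto simp: nth_append)
    then show False using that by (simp add: y_def)
  qed
  have "blocked_corners l 0 (q @ [x])"
    unfolding blocked_corners_def
  proof (intro allI impI)
    fix i
    assume i: "Suc (Suc i) < length (q @ [x])" and L: "(q @ [x]) ! Suc i = (q @ [x]) ! i - 1"
      and R: "(q @ [x]) ! Suc (Suc i) = (q @ [x]) ! i"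
    show "l (0 + Suc i) ((q @ [x]) ! i + 1) \<noteq> 0"
    proof (cases "Suc (Suc i) < length q")
      case True
      then show ?thesis using q(2) L R by (auto simp: blocked_corners_def nth_append)
    next
      case False
      then have "s = Suc i" using i q(3) by simp
      then show ?thesis using corner[of i] L R q(3,4) by (auto simp: nth_append)
    qed
  qed
  moreover have "diag_steps l 0 (q @ [x])"
    using q x0 by (intro diag_steps_snoc[where s = s]) (auto simp: y_def)
  ultimately show ?case using q(3) by (intro exI[of _ "q @ [x]"]) (auto simp: nth_append)
qed

section \<open>The renewal inequalities for diagonal paths\<close>

definition diag_from :: "nat \<Rightarrow> nat \<Rightarrow> int \<Rightarrow> (int \<Rightarrow> nat) \<Rightarrow> bool" where
  "diag_from n s x w \<longleftrightarrow> (\<exists>p. length p = Suc n \<and> p ! 0 = x \<and>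
    diag_steps (ca w) s p \<and> blocked_corners (ca w) s p)"

text \<open>A path with a left first step is a separate state, because only the next step decides
  whether it begins a corner.\<close>

definition diag_from_left :: "nat \<Rightarrow> nat \<Rightarrow> int \<Rightarrow> (int \<Rightarrow> nat) \<Rightarrow> bool" where
  "diag_from_left n s x w \<longleftrightarrow> (\<exists>p. length p = Suc n \<and> 0 < n \<and> p ! 0 = x \<and> p ! 1 = x - 1 \<and>
    diag_steps (ca w) s p \<and> blocked_corners (ca w) s p)"

lemma sets_diag_from [measurable]:
  "{w \<in> space uniform_config. diag_from n s x w} \<in> sets uniform_config"
  "{w \<in> space uniform_config. diag_from_left n s x w} \<in> sets uniform_config"
  unfolding diag_from_def diag_from_left_def diag_steps_def blocked_corners_def by measurable

lemma diag_from_cases: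
  assumes "diag_from (Suc n) s x w"
  shows "diag_from n (Suc s) (x + 1) w \<and> ca w (Suc s) (x + 1) = 0 \<or> diag_from_left (Suc n) s x w"
proof -
  obtain p where p: "length p = Suc (Suc n)" "p ! 0 = x" "diag_steps (ca w) s p" "blocked_corners (ca w) s p"
    using assms unfolding diag_from_def by auto
  have "\<bar>p ! 1 - x\<bar> = 1" and zero: "ca w (Suc s) (p ! 1) = 0"
    using p unfolding diag_steps_def by (auto dest: spec[of _ 0] spec[of _ 1])
  then consider "p ! 1 = x + 1" | "p ! 1 = x - 1" by linarith
  then show ?thesis
  proof cases
    case 1
    then have "diag_from n (Suc s) (x + 1) w"
      unfolding diag_from_def
      using p diag_steps_drop[OF p(3), of 1] blocked_corners_drop[OF p(4), of 1]
      by (intro exI[of _ "drop 1 p"]) auto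
    then show ?thesis using 1 zero by simp
  next
    case 2
    then show ?thesis using p unfolding diag_from_left_def by auto
  qed
qed

text \<open>A right step after the left one determines three sites at time \<open>Suc s\<close>:
  \<open>x - 1\<close> is on the path, \<open>x + 1\<close> is occupied because the corner is
  blocked, and then \<open>x\<close> is occupied by parity because the path returns to an empty site
  above it.\<close>

lemma diag_from_left_cases:
  assumes "w \<in> space uniform_config" and "diag_from_left (Suc n) s x w"
  shows "ca w (Suc s) (x - 1) = 0 \<and> (n = 0 \<or> diag_from_left n (Suc s) (x - 1) w \<or>
    (\<exists>m. n = Suc m \<and> ca w (Suc s) x = 1 \<and> ca w (Suc s) (x + 1) = 1 \<and> diag_from m (Suc (Suc s)) x w))"
proof -
  obtain p where p: "length p = Suc (Suc n)" "p ! 0 = x" "p ! 1 = x - 1"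
    "diag_steps (ca w) s p" "blocked_corners (ca w) s p"
    using assms unfolding diag_from_left_def by auto
  have zero: "ca w (Suc s) (x - 1) = 0"
    using p unfolding diag_steps_def by (auto dest: spec[of _ 1])
  show ?thesis
  proof (cases n)
    case (Suc m)
    have "\<bar>p ! 2 - p ! 1\<bar> = 1" and zero2: "ca w (Suc (Suc s)) (p ! 2) = 0"
      using p(1,4) Suc unfolding diag_steps_def by (auto simp: numeral_2_eq_2 dest: spec[of _ 1] spec[of _ 2])
    then consider "p ! 2 = x" | "p ! 2 = x - 2" using p(3) by linarith
    then show ?thesis
    proof cases
      case 1
      have "ca w (Suc s) (x + 1) \<noteq> 0"
        using p 1 Suc unfolding blocked_corners_def by (auto simp: numeral_2_eq_2 dest: spec[of _ 0])
      then have right: "ca w (Suc s) (x + 1) = 1" using ca_le_1[OF assms(1), of "Suc s" "x + 1"] by linarith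
      have "(ca w (Suc s) (x - 1) + ca w (Suc s) x + ca w (Suc s) (x + 1)) mod 2 = 0"
        using zero2 1 by simp
      then have "ca w (Suc s) x \<noteq> 0" using zero right by (intro notI) (simp del: one_or_three.simps)
      then have "ca w (Suc s) x = 1" using ca_le_1[OF assms(1), of "Suc s" x] by linarith
      moreover have "diag_from m (Suc (Suc s)) x w"
        unfolding diag_from_def
        using p 1 Suc diag_steps_drop[OF p(4), of 2] blocked_corners_drop[OF p(5), of 2]
        by (intro exI[of _ "drop 2 p"]) auto
      ultimately show ?thesis using zero right Suc by blast
    next
      case 2
      then have "diag_from_left n (Suc s) (x - 1) w"
        unfolding diag_from_left_def
        using p Suc diag_steps_drop[OF p(4), of 1] blocked_corners_drop[OF p(5), of 1]
        by (intro exI[of _ "drop 1 p"]) (auto simp: numeral_2_eq_2)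
      then show ?thesis using zero by blast
    qed
  qed (use zero in simp)
qed

text \<open>For the two probabilities \<open>D n\<close> and \<open>L n\<close> the case
  distinctions give \<open>D n \<le> D (n - 1) / 2 + L n\<close> and
  \<open>L n \<le> L (n - 1) / 2 + D (n - 2) / 8\<close>. Rate 7/8 with factors 2 and 4/5 satisfies
  both: \<open>1 + 7 / 10 \<le> 7 / 4\<close> and
  \<open>7 / 20 + 1 / 4 \<le> 49 / 80\<close>.\<close>

lemma measure_diag_from:
  assumes "localized (x - int s) (x + int s) S"
  shows "measure uniform_config (S \<inter> {w \<in> space uniform_config. diag_from n s x w})
      \<le> 2 * (7 / 8) ^ n * measure uniform_config S"
    and "measure uniform_config (S \<inter> {w \<in> space uniform_config. diag_from_left n s x w})
      \<le> 4 / 5 * (7 / 8) ^ n * measure uniform_config S"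
  using assms
proof (induction n arbitrary: s x S rule: less_induct)
  case (less n)
  let ?P = "measure uniform_config" and ?sp = "space uniform_config"
  let ?D = "\<lambda>n s x. {w \<in> ?sp. diag_from n s x w}" and ?L = "\<lambda>n s x. {w \<in> ?sp. diag_from_left n s x w}"
  let ?C = "\<lambda>s x v. {w \<in> ?sp. ca w s x = v}"
  {
    \<comment> \<open>This bound comes first, since the one for \<open>diag_from\<close> uses it at
      the same \<open>n\<close>.\<close>
    case 2
    note S = this
    note [measurable] = localized_sets[OF S]
    show ?case
    proof (cases n)
      case 0
      then show ?thesis by (simp add: diag_from_left_def)
    next
      case (Suc k)
      let ?S0 = "S \<inter> ?C (Suc s) (x - 1) 0"
      \<comment> \<open>The middle site is revealed first: once both its neighbours were known, the
        known interval would cover its dependence interval, and it would give no fresh bit.\<close>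
      let ?S1 = "S \<inter> ?C (Suc s) x 1"
      let ?S2 = "?S1 \<inter> ?C (Suc s) (x - 1) 0"
      let ?S3 = "?S2 \<inter> ?C (Suc s) (x + 1) 1"
      have S0: "?P ?S0 = ?P S / 2" "localized (x - 1 - int (Suc s)) (x - 1 + int (Suc s)) ?S0"
        by (intro measure_Int_ca[OF S] localized_Int_ca localized_mono[OF S]; simp)+
      have "?P ?S1 = ?P S / 2"
        by (intro measure_Int_ca[OF S]) auto
      moreover have S1: "localized (x - 1 - int s) (x + 1 + int s) ?S1"
        by (rule localized_Int_ca[OF localized_mono[OF S]]) simp_all
      moreover have "?P ?S2 = ?P ?S1 / 2"
        by (intro measure_Int_ca[OF S1]) auto
      moreover have S2: "localized (x - 2 - int s) (x + 1 + int s) ?S2"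
        by (rule localized_Int_ca[OF localized_mono[OF S1]]) simp_all
      moreover have "?P ?S3 = ?P ?S2 / 2"
        by (intro measure_Int_ca[OF S2]) auto
      ultimately have S3: "?P ?S3 = ?P S / 8" by simp
      have S3_loc: "localized (x - int (Suc (Suc s))) (x + int (Suc (Suc s))) ?S3"
        by (rule localized_Int_ca[OF localized_mono[OF S2]]) simp_all
      show ?thesis
      proof (cases k)
        case 0
        have "?P (S \<inter> ?L n s x) \<le> ?P ?S0"
        proof (rule uc.finite_measure_mono)
          show "S \<inter> ?L n s x \<subseteq> ?S0" using diag_from_left_cases[of _ k s x] Suc by auto
        qed measurable
        also have "\<dots> = 1 / 2 * ?P S" using S0(1) by linarith
        also have "\<dots> \<le> 7 / 10 * ?P S" by (intro mult_right_mono) auto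
        finally show ?thesis by (simp add: Suc 0 del: one_or_three.simps)
      next
        case k: (Suc m)
        have "?P (S \<inter> ?L n s x) \<le> ?P (?S0 \<inter> ?L k (Suc s) (x - 1) \<union> ?S3 \<inter> ?D m (Suc (Suc s)) x)"
        proof (rule uc.finite_measure_mono)
          show "S \<inter> ?L n s x \<subseteq> ?S0 \<inter> ?L k (Suc s) (x - 1) \<union> ?S3 \<inter> ?D m (Suc (Suc s)) x"
            using diag_from_left_cases[of _ k s x] Suc k by (fastforce simp del: one_or_three.simps)
        qed measurable
        also have "\<dots> \<le> ?P (?S0 \<inter> ?L k (Suc s) (x - 1)) + ?P (?S3 \<inter> ?D m (Suc (Suc s)) x)"
          by (intro measure_Un_le) measurable
        also have "\<dots> \<le> 4 / 5 * (7 / 8) ^ k * (?P S / 2) + 2 * (7 / 8) ^ m * (?P S / 8)"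
        proof (rule add_mono)
          have "?P (?S0 \<inter> ?L k (Suc s) (x - 1)) \<le> 4 / 5 * (7 / 8) ^ k * ?P ?S0"
            by (rule less.IH(2)[OF _ S0(2)]) (simp add: Suc)
          then show "?P (?S0 \<inter> ?L k (Suc s) (x - 1)) \<le> 4 / 5 * (7 / 8) ^ k * (?P S / 2)"
            by (simp only: S0(1))
          have "?P (?S3 \<inter> ?D m (Suc (Suc s)) x) \<le> 2 * (7 / 8) ^ m * ?P ?S3"
            by (rule less.IH(1)[OF _ S3_loc]) (simp add: Suc k)
          then show "?P (?S3 \<inter> ?D m (Suc (Suc s)) x) \<le> 2 * (7 / 8) ^ m * (?P S / 8)"
            by (simp only: S3)
        qed
        also have "\<dots> = 3 / 5 * (7 / 8) ^ m * ?P S"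
          by (simp add: k)
        also have "\<dots> \<le> 4 / 5 * (7 / 8) ^ n * ?P S"
          by (simp add: k Suc mult_right_mono)
        finally show ?thesis .
      qed
    qed
  }
  note left = this
  case 1
  note S = this
  note [measurable] = localized_sets[OF S]
  show ?case
  proof (cases n)
    case 0
    have "?P (S \<inter> ?D n s x) \<le> 1 * ?P S" by (simp add: uc.finite_measure_mono)
    also have "\<dots> \<le> 2 * ?P S" by (intro mult_right_mono) auto
    finally show ?thesis by (simp add: 0)
  next
    case (Suc k)
    let ?S0 = "S \<inter> ?C (Suc s) (x + 1) 0"
    have S0: "?P ?S0 = ?P S / 2" "localized (x + 1 - int (Suc s)) (x + 1 + int (Suc s)) ?S0"
      by (intro measure_Int_ca[OF S] localized_Int_ca localized_mono[OF S]; simp)+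
    have "?P (S \<inter> ?D n s x) \<le> ?P (?S0 \<inter> ?D k (Suc s) (x + 1) \<union> S \<inter> ?L n s x)"
    proof (rule uc.finite_measure_mono)
      show "S \<inter> ?D n s x \<subseteq> ?S0 \<inter> ?D k (Suc s) (x + 1) \<union> S \<inter> ?L n s x"
        using diag_from_cases[of k s x] Suc by auto
    qed measurable
    also have "\<dots> \<le> ?P (?S0 \<inter> ?D k (Suc s) (x + 1)) + ?P (S \<inter> ?L n s x)"
      by (intro measure_Un_le) measurable
    also have "\<dots> \<le> 2 * (7 / 8) ^ k * (?P S / 2) + 4 / 5 * (7 / 8) ^ n * ?P S"
    proof (rule add_mono)
      have "?P (?S0 \<inter> ?D k (Suc s) (x + 1)) \<le> 2 * (7 / 8) ^ k * ?P ?S0"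
        by (rule less.IH(1)[OF _ S0(2)]) (simp add: Suc)
      then show "?P (?S0 \<inter> ?D k (Suc s) (x + 1)) \<le> 2 * (7 / 8) ^ k * (?P S / 2)"
        by (simp only: S0(1))
      show "?P (S \<inter> ?L n s x) \<le> 4 / 5 * (7 / 8) ^ n * ?P S" by (rule left[OF S])
    qed
    also have "\<dots> = 17 / 10 * (7 / 8) ^ k * ?P S"
      by (simp add: Suc)
    also have "\<dots> \<le> 2 * (7 / 8) ^ n * ?P S"
      by (simp add: Suc mult_right_mono)
    finally show ?thesis .
  qed
qed

section \<open>From space-time paths to lists of positions\<close>

lemma st_path_from_line:
  assumes "st_path_from_to (UNIV \<times> {0}) (y, t) p"
  shows "length p = Suc t" "\<And>i. i \<le> t \<Longrightarrow> snd (p ! i) = i" "fst (p ! t) = y"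
    "\<bar>fst (p ! 0) - y\<bar> \<le> int t"
proof -
  have p: "st_path p" "p \<noteq> []" "snd (hd p) = 0" "last p = (y, t)"
    using assms by (auto simp: st_path_from_to_def st_path_def)
  have time: "i < length p \<Longrightarrow> snd (p ! i) = i" for i
  proof (induction i)
    case 0
    then show ?case using p by (simp add: hd_conv_nth)
  next
    case (Suc i)
    then show ?case using p(1) unfolding st_path_def by auto
  qed
  have last: "p ! (length p - 1) = (y, t)" using p(2,4) by (simp add: last_conv_nth)
  then show len: "length p = Suc t" using time[of "length p - 1"] p(2) by (cases p) auto
  then show "\<And>i. i \<le> t \<Longrightarrow> snd (p ! i) = i" using time by simp
  show last_fst: "fst (p ! t) = y" using last len by simp
  have "i < length p \<Longrightarrow> \<bar>fst (p ! 0) - fst (p ! i)\<bar> \<le> int i" for i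
  proof (induction i)
    case (Suc i)
    then have "\<bar>fst (p ! Suc i) - fst (p ! i)\<bar> \<le> 1" using p(1) unfolding st_path_def by auto
    then show ?case using Suc by auto
  qed simp
  from this[of t] show "\<bar>fst (p ! 0) - y\<bar> \<le> int t" using len last_fst by simp
qed

lemma empty_path_nth: "empty_path l p \<Longrightarrow> i < length p \<Longrightarrow> l (snd (p ! i)) (fst (p ! i)) = 0"
  unfolding empty_path_def by (metis (mono_tags, lifting) case_prod_beta nth_mem)

lemma diag_from_if_diagonal_path:
  assumes p: "st_path_from_to (UNIV \<times> {0}) (0, t) p" "diagonal_path p" "empty_path (ca w) p"
  shows "\<exists>x\<in>{- int t..int t}. diag_from t 0 x w"
proof -
  note path = st_path_from_line[OF p(1)]
  have "diag_steps (ca w) 0 (map fst p)"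
    using p(2) path empty_path_nth[OF p(3)] unfolding diag_steps_def diagonal_path_def
    by (auto simp: less_Suc_eq_le)
  from ex_blocked_corners[OF this, of t 0] path obtain q where q: "diag_steps (ca w) 0 q"
    "blocked_corners (ca w) 0 q" "length q = Suc t" "q ! t = 0" by auto
  \<comment> \<open>The path \<open>q\<close> need not start where \<open>p\<close> does, but it
    also ends at 0, which confines its starting point.\<close>
  have "i \<le> t \<Longrightarrow> \<bar>q ! 0 - q ! i\<bar> \<le> int i" for i
  proof (induction i)
    case (Suc i)
    then have "\<bar>q ! Suc i - q ! i\<bar> = 1" using q unfolding diag_steps_def by auto
    then show ?case using Suc by auto
  qed simp
  from this[of t] have "q ! 0 \<in> {- int t..int t}" using q(4) by auto
  then show ?thesis using q unfolding diag_from_def by blast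
qed

lemma wide_from_if_wide_path:
  assumes p: "st_path_from_to (UNIV \<times> {0}) (0, t) p" "wide_path (ca w) p"
  shows "\<exists>x\<in>{- int t..int t}. wide_from t 0 x w"
proof -
  note path = st_path_from_line[OF p(1)]
  have p': "st_path p" "empty_path (ca w) p" using p by (auto simp: wide_path_def st_path_from_to_def)
  have nth: "p ! i = (fst (p ! i), i)" if "i \<le> t" for i using path(2)[OF that] by (metis prod.collapse)
  have "wide_steps (ca w) 0 (map fst p)"
    unfolding wide_steps_def
  proof (intro conjI allI impI)
    fix i assume "i < length (map fst p)"
    then show "ca w (0 + i) (map fst p ! i) = 0"
      using empty_path_nth[OF p'(2), of i] path by simp
  next
    fix i assume i: "Suc i < length (map fst p)"
    then show "\<bar>map fst p ! Suc i - map fst p ! i\<bar> \<le> 1" using p'(1) unfolding st_path_def by auto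
    have "p ! i = (fst (p ! i), i)" "p ! Suc i = (fst (p ! Suc i), i + 1)"
      using i path(1) nth[of i] nth[of "Suc i"] by auto
    then show "\<not> (\<bar>map fst p ! Suc i - map fst p ! i\<bar> = 1 \<and> ca w (0 + i) (map fst p ! Suc i) = 1 \<and>
        ca w (0 + Suc i) (map fst p ! i) = 1)"
      using p(2) i unfolding wide_path_def
      by (auto simp del: one_or_three.simps simp: abs_minus_commute)
  qed
  \<comment> \<open>The start of the path is itself the reference point, so the segment in
    \<open>wide_from\<close> is this single site.\<close>
  moreover have "ca w 0 (fst (p ! 0)) = 0"
    using empty_path_nth[OF p'(2), of 0] path(1) path(2)[of 0] by simp
  ultimately have "wide_from t 0 (fst (p ! 0)) w"
    unfolding wide_from_def using path(1) by (intro exI[of _ "map fst p"]) auto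
  then show ?thesis using path(4) by (intro bexI[of _ "fst (p ! 0)"]) auto
qed

section \<open>Exponential decay from the union bound\<close>

lemma exponential_decay:
  fixes P :: "nat \<Rightarrow> real"
  assumes half: "\<And>t. P t \<le> 1 / 2" and bound: "\<And>t. P t \<le> real (2 * t + 1) * (2 * (7 / 8) ^ t)"
  shows "\<exists>c>0. \<forall>t>0. P t < exp (- c * real t)"
proof -
  have "eventually (\<lambda>t::nat. real (2 * t + 1) * (2 * (7 / 8) ^ t) < (15 / 16) ^ t) sequentially"
    by real_asymp
  then obtain N where N: "\<And>t. t \<ge> N \<Longrightarrow> real (2 * t + 1) * (2 * (7 / 8) ^ t) < (15 / 16) ^ t"
    by (auto simp: eventually_sequentially)
  \<comment> \<open>The first term serves \<open>t \<ge> N\<close>, where 15/16 has absorbed the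
    polynomial factor. The second makes the right-hand side exceed 1/2 for the finitely many smaller
    \<open>t\<close>.\<close>
  define c where "c = min (ln (16 / 15)) (ln 2 / real (N + 1))"
  have "P t < exp (- c * real t)" for t
  proof (cases "t \<ge> N")
    case True
    have "(15 / 16 :: real) ^ t = exp (real t * ln (15 / 16))" by (simp add: exp_of_nat_mult)
    also have "ln (15 / 16 :: real) = - ln (16 / 15)" by (simp add: ln_div)
    also have "exp (real t * - ln (16 / 15)) \<le> exp (- c * real t)"
      by (simp add: c_def mult.commute mult_left_mono)
    finally show ?thesis using bound[of t] N[OF True] by linarith
  next
    case False
    have "c * real t \<le> ln 2 / real (N + 1) * real t"
      by (intro mult_right_mono) (auto simp: c_def)
    also have "\<dots> < ln 2"
      using False mult_strict_right_mono[of "real t" "real (N + 1)" "ln 2"] by (simp add: field_simps)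
    finally have "exp (- ln 2) < exp (- c * real t)" by simp
    then show ?thesis using half[of t] by (simp add: exp_minus)
  qed
  moreover have "c > 0" by (simp add: c_def)
  ultimately show ?thesis by blast
qed

text \<open>A path ending at \<open>(0, t)\<close> has at most \<open>2 * t + 1\<close> starting
  points, which gives the union bound. It says nothing for small \<open>t\<close>, where the value
  at the end point alone gives 1/2.\<close>

lemma decay_by_starting_points:
  fixes E :: "nat \<Rightarrow> (int \<Rightarrow> nat) \<Rightarrow> bool" and D :: "nat \<Rightarrow> int \<Rightarrow> (int \<Rightarrow> nat) \<Rightarrow> bool"
  assumes zero: "\<And>t w. E t w \<Longrightarrow> ca w t 0 = 0"
    and start: "\<And>t w. E t w \<Longrightarrow> \<exists>x\<in>{- int t..int t}. D t x w"
    and sets: "\<And>t x. {w \<in> space uniform_config. D t x w} \<in> sets uniform_config"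
    and bound: "\<And>t x. measure uniform_config {w \<in> space uniform_config. D t x w} \<le> 2 * (7 / 8) ^ t"
  shows "\<exists>c>0. \<forall>t>0. \<P>(w in uniform_config. E t w) < exp (- c * real t)"
proof (rule exponential_decay)
  fix t
  let ?P = "measure uniform_config" and ?sp = "space uniform_config"
  have "?P {w \<in> ?sp. E t w} \<le> ?P (?sp \<inter> {w \<in> ?sp. ca w t 0 = 0})"
    using zero by (intro uc.finite_measure_mono) auto
  \<comment> \<open>The interval from 1 to 0 is empty: the whole space is invariant under every
    flip.\<close>
  also have "\<dots> = ?P ?sp / 2"
    by (intro measure_Int_ca[of 1 0]) (auto simp: localized_def flip_in_space)
  finally show "\<P>(w in uniform_config. E t w) \<le> 1 / 2" by (simp add: uc.prob_space)
  have "?P {w \<in> ?sp. E t w} \<le> ?P (\<Union>x\<in>{- int t..int t}. {w \<in> ?sp. D t x w})"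
    using start sets by (intro uc.finite_measure_mono) auto
  also have "\<dots> \<le> (\<Sum>x\<in>{- int t..int t}. ?P {w \<in> ?sp. D t x w})"
    using sets by (intro uc.finite_measure_subadditive_finite) auto
  also have "\<dots> \<le> (\<Sum>x\<in>{- int t..int t}. 2 * (7 / 8) ^ t)"
    by (intro sum_mono bound)
  finally show "\<P>(w in uniform_config. E t w) \<le> real (2 * t + 1) * (2 * (7 / 8) ^ t)"
    by (simp add: nat_add_distrib)
qed

theorem theorem1p5:
  shows "(\<exists>c::real. c > 0 \<and> (\<forall>t::nat. t > 0 \<longrightarrow>
            \<P>(w in uniform_config. \<exists>p. st_path_from_to (UNIV \<times> {0}) (0, t) p \<and>
               diagonal_path p \<and> empty_path (one_or_three w) p) < exp (- c * real t))) \<and>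
         (\<exists>c::real. c > 0 \<and> (\<forall>t::nat. t > 0 \<longrightarrow>
            \<P>(w in uniform_config. \<exists>p. st_path_from_to (UNIV \<times> {0}) (0, t) p \<and>
               wide_path (one_or_three w) p) < exp (- c * real t)))"
proof
  have target: "ca w t 0 = 0" if "st_path_from_to (UNIV \<times> {0}) (0, t) p" "empty_path (ca w) p" for w t p
    using empty_path_nth[OF that(2), of t] st_path_from_line[OF that(1)] by simp
  have loc: "localized (x - int 0) (x + int 0) (space uniform_config)" for x
    by (rule localized_space)
  show "\<exists>c::real. c > 0 \<and> (\<forall>t::nat. t > 0 \<longrightarrow>
    \<P>(w in uniform_config. \<exists>p. st_path_from_to (UNIV \<times> {0}) (0, t) p \<and>
      diagonal_path p \<and> empty_path (one_or_three w) p) < exp (- c * real t))"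
  proof (rule decay_by_starting_points[where D = "\<lambda>t. diag_from t 0"])
    fix t x
    show "measure uniform_config {w \<in> space uniform_config. diag_from t 0 x w} \<le> 2 * (7 / 8) ^ t"
      using measure_diag_from(1)[OF loc, of t x] by (simp add: Int_def uc.prob_space)
  next
    fix t w
    assume "\<exists>p. st_path_from_to (UNIV \<times> {0}) (0, t) p \<and> diagonal_path p \<and> empty_path (ca w) p"
    then obtain p where "st_path_from_to (UNIV \<times> {0}) (0, t) p" "diagonal_path p" "empty_path (ca w) p"
      by blast
    then show "\<exists>x\<in>{- int t..int t}. diag_from t 0 x w" "ca w t 0 = 0"
      using target diag_from_if_diagonal_path by auto
  qed measurable
  show "\<exists>c::real. c > 0 \<and> (\<forall>t::nat. t > 0 \<longrightarrow>
    \<P>(w in uniform_config. \<exists>p. st_path_from_to (UNIV \<times> {0}) (0, t) p \<and>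
      wide_path (one_or_three w) p) < exp (- c * real t))"
  proof (rule decay_by_starting_points[where D = "\<lambda>t. wide_from t 0"])
    fix t x
    have "measure uniform_config {w \<in> space uniform_config. wide_from t 0 x w} \<le> 2 * (3 / 4) ^ t"
      using measure_wide_from[OF loc, of t x] by (simp add: Int_def uc.prob_space)
    \<comment> \<open>The rate 3/4 is weakened to the common rate 7/8 of
      \<open>decay_by_starting_points\<close>.\<close>
    also have "\<dots> \<le> 2 * (7 / 8) ^ t" by (simp add: power_mono)
    finally show "measure uniform_config {w \<in> space uniform_config. wide_from t 0 x w} \<le> 2 * (7 / 8) ^ t" .
  next
    fix t w
    assume "\<exists>p. st_path_from_to (UNIV \<times> {0}) (0, t) p \<and> wide_path (ca w) p"
    then obtain p where p: "st_path_from_to (UNIV \<times> {0}) (0, t) p" "wide_path (ca w) p" by blast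
    then show "\<exists>x\<in>{- int t..int t}. wide_from t 0 x w" by (rule wide_from_if_wide_path)
    show "ca w t 0 = 0" using p by (intro target) (auto simp: wide_path_def)
  qed measurable
qed

end
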